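(* Let $A=[a_1,\ldots,a_r]$ and $B=[b_1,\ldots,b_s]$ (with $s\ge 1$) be finite sequences of non-negative integers with $a_1+\cdots+a_r=b_1+\cdots+b_s$. Then \[ N_{A,B} = \sum_{\substack{I\subseteq\{1,\ldots,r\}\\ |I|=b_1}} N_{A_I,B'} , \] where $B'=[b_2,\ldots,b_s]$ and $A_I=[a_1',\ldots,a_r']$ with $a_i' = a_i - \mathbf{1}_I(i)$, $\mathbf{1}_I$ being the indicator function of the set $I$.
   Context: For finite sequences $A=[a_1,\ldots,a_r]$ and $B=[b_1,\ldots,b_s]$ of integers with equal sums, $N_{A,B}$ is the number of simple vertex-labelled bipartite graphs $(U,V,E)$ with $U=\{u_1,\ldots,u_r\}$, $V=\{v_1,\ldots,v_s\}$ (fixed labelled vertices, at most one edge between any $u_i$ and $v_j$, i.e. $E\subseteq U\times V$) such that $\deg(u_i)=a_i$ for all $i$ and $\deg(v_j)=b_j$ for all $j$. If some entry of $A$ or $B$ is negative, there are no such graphs and $N_{A,B}=0$. *)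

theory Defs
  imports Main
begin

text \<open>
  A simple bipartite graph on the fixed labelled vertices u_0, ..., u_(r-1) and v_0, ..., v_(s-1)
  is its edge set E, a set of pairs (i, j) standing for the edge between u_i and v_j.
  Indices start at 0, as for lists.
\<close>

definition bipartite_graphs :: "nat \<Rightarrow> nat \<Rightarrow> (nat \<times> nat) set set" where
  "bipartite_graphs r s = Pow ({..<r} \<times> {..<s})"

definition deg_U :: "(nat \<times> nat) set \<Rightarrow> nat \<Rightarrow> nat" where
  "deg_U E i = card {j. (i, j) \<in> E}"

definition deg_V :: "(nat \<times> nat) set \<Rightarrow> nat \<Rightarrow> nat" where
  "deg_V E j = card {i. (i, j) \<in> E}"

text \<open>
  Prescribed degrees are integers, since lowering an entry 0 by 1 must give -1 and not 0.
  No graph realizes a negative entry, so the number is then 0.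
\<close>

definition num_bipartite :: "int list \<Rightarrow> int list \<Rightarrow> nat" where
  "num_bipartite A B = card {E \<in> bipartite_graphs (length A) (length B).
     (\<forall>i < length A. int (deg_U E i) = A ! i) \<and>
     (\<forall>j < length B. int (deg_V E j) = B ! j)}"

definition decrement_on :: "nat set \<Rightarrow> int list \<Rightarrow> int list" where
  "decrement_on I A = map (\<lambda>i. A ! i - of_bool (i \<in> I)) [0..<length A]"

end

theory Submission
  imports Defs
begin

text \<open>
  A graph is determined by the neighbourhood I of its first vertex in V together with the graph
  left after deleting that vertex. Deletion keeps the other degrees in V and lowers the degree of
  u_i by 1 exactly when i lies in I, so the graphs with degrees A, B correspond bijectively to the
  pairs of a set I with b_1 elements and a graph with degrees A_I, B'.
\<close>

text \<open>The set whose cardinality is \<open>num_bipartite A B\<close>, named so that a bijection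
  onto it can be stated.\<close>

definition realizations :: "int list \<Rightarrow> int list \<Rightarrow> (nat \<times> nat) set set" where
  "realizations A B = {E \<in> bipartite_graphs (length A) (length B).
     (\<forall>i < length A. int (deg_U E i) = A ! i) \<and>
     (\<forall>j < length B. int (deg_V E j) = B ! j)}"

text \<open>The new vertex takes index 0 and the old vertices of V move up by one. No index bounds
  are imposed, so \<open>add_first\<close> and \<open>delete_first\<close> are mutually inverse on
  arbitrary sets of pairs.\<close>

definition add_first :: "nat set \<Rightarrow> (nat \<times> nat) set \<Rightarrow> (nat \<times> nat) set" where
  "add_first I F = {(i, j). case j of 0 \<Rightarrow> i \<in> I | Suc k \<Rightarrow> (i, k) \<in> F}"

definition delete_first :: "(nat \<times> nat) set \<Rightarrow> (nat \<times> nat) set" where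
  "delete_first E = {(i, j). (i, Suc j) \<in> E}"

lemma in_add_first [simp]:
  "(i, 0) \<in> add_first I F \<longleftrightarrow> i \<in> I"
  "(i, Suc j) \<in> add_first I F \<longleftrightarrow> (i, j) \<in> F"
  by (simp_all add: add_first_def)

lemma add_first_delete_first: "add_first {i. (i, 0) \<in> E} (delete_first E) = E"
proof (rule set_eqI)
  fix p :: "nat \<times> nat"
  obtain i j where "p = (i, j)" by fastforce
  then show "p \<in> add_first {i. (i, 0) \<in> E} (delete_first E) \<longleftrightarrow> p \<in> E"
    by (cases j) (simp_all add: delete_first_def)
qed

lemma delete_first_add_first: "delete_first (add_first I F) = F"
  by (simp add: delete_first_def)

lemma add_first_in_bipartite_graphs_iff:
  "add_first I F \<in> bipartite_graphs r (Suc s) \<longleftrightarrow> I \<subseteq> {..<r} \<and> F \<in> bipartite_graphs r s"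
  by (fastforce simp: bipartite_graphs_def add_first_def split: nat.splits)

lemma deg_V_add_first [simp]:
  "deg_V (add_first I F) 0 = card I"
  "deg_V (add_first I F) (Suc j) = deg_V F j"
  by (simp_all add: deg_V_def)

text \<open>The graph hypothesis makes neighbourhoods finite; \<open>card\<close> is 0 on an
  infinite set, where adding a neighbour would not raise it.\<close>

lemma deg_U_add_first:
  assumes "F \<in> bipartite_graphs r s"
  shows "deg_U (add_first I F) i = of_bool (i \<in> I) + deg_U F i"
proof -
  have "{j. (i, j) \<in> F} \<subseteq> {..<s}"
    using assms by (auto simp: bipartite_graphs_def)
  then have fin: "finite {j. (i, j) \<in> F}"
    by (rule finite_subset) simp
  \<comment> \<open>\<open>Suc\<close> is injective and never 0, so the union is disjoint and the
    image keeps the cardinality.\<close>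
  have "{j. (i, j) \<in> add_first I F} = (if i \<in> I then {0} else {}) \<union> Suc ` {j. (i, j) \<in> F}"
  proof (rule set_eqI)
    fix j
    show "j \<in> {j. (i, j) \<in> add_first I F} \<longleftrightarrow>
        j \<in> (if i \<in> I then {0} else {}) \<union> Suc ` {j. (i, j) \<in> F}"
      by (cases j) auto
  qed
  then show ?thesis
    using fin by (auto simp: deg_U_def card_image)
qed

lemma length_decrement_on [simp]: "length (decrement_on I A) = length A"
  by (simp add: decrement_on_def)

lemma nth_decrement_on [simp]: "i < length A \<Longrightarrow> decrement_on I A ! i = A ! i - of_bool (i \<in> I)"
  by (simp add: decrement_on_def)

text \<open>Vertex 0 of V gives the condition on \<open>card I\<close>; at u_i the indicator moves
  to the other side, which is exact over the integers. Being an equivalence, this serves both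
  directions of the bijection.\<close>

lemma add_first_in_realizations_iff:
  "add_first I F \<in> realizations A (b # B) \<longleftrightarrow>
    I \<subseteq> {..<length A} \<and> int (card I) = b \<and> F \<in> realizations (decrement_on I A) B"
\<comment> \<open>The formula for \<open>deg_U\<close> requires \<open>F\<close> to be a graph;
  otherwise both sides are false.\<close>
proof (cases "F \<in> bipartite_graphs (length A) (length B)")
  case True
  then show ?thesis
    by (auto simp: realizations_def add_first_in_bipartite_graphs_iff deg_U_add_first
        All_less_Suc2 algebra_simps)
next
  case False
  then show ?thesis
    by (simp add: realizations_def add_first_in_bipartite_graphs_iff)
qed

lemma finite_realizations: "finite (realizations A B)"
  by (simp add: realizations_def bipartite_graphs_def)

lemma num_bipartite_Cons:
  "num_bipartite A (b # B) =
    (\<Sum>I | I \<subseteq> {..<length A} \<and> int (card I) = b. num_bipartite (decrement_on I A) B)"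
proof -
  let ?Is = "{I. I \<subseteq> {..<length A} \<and> int (card I) = b}"
  let ?P = "Sigma ?Is (\<lambda>I. realizations (decrement_on I A) B)"
  have "bij_betw (\<lambda>(I, F). add_first I F) ?P (realizations A (b # B))"
  proof (rule bij_betw_byWitness[where f' = "\<lambda>E. ({i. (i, 0) \<in> E}, delete_first E)"])
    \<comment> \<open>The equivalence applies once \<open>E\<close> is rewritten as
      \<open>add_first\<close> of its two parts.\<close>
    show "(\<lambda>E. ({i. (i, 0) \<in> E}, delete_first E)) ` realizations A (b # B) \<subseteq> ?P"
    proof
      fix p assume "p \<in> (\<lambda>E. ({i. (i, 0) \<in> E}, delete_first E)) ` realizations A (b # B)"
      then obtain E where "E \<in> realizations A (b # B)" "p = ({i. (i, 0) \<in> E}, delete_first E)"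
        by blast
      then show "p \<in> ?P"
        using add_first_in_realizations_iff[of "{i. (i, 0) \<in> E}" "delete_first E" A b B]
        by (simp add: add_first_delete_first)
    qed
  qed (auto simp: add_first_delete_first delete_first_add_first add_first_in_realizations_iff)
  then have "card (realizations A (b # B)) = card ?P"
    by (simp add: bij_betw_same_card)
  also have "\<dots> = (\<Sum>I\<in>?Is. card (realizations (decrement_on I A) B))"
    by (simp add: finite_realizations)
  finally show ?thesis
    by (simp add: num_bipartite_def realizations_def)
qed

theorem proposition2p3:
  fixes A B :: "int list"
  assumes "length B \<ge> 1"
    and "\<forall>a \<in> set A. a \<ge> 0"
    and "\<forall>b \<in> set B. b \<ge> 0"
    and "sum_list A = sum_list B"
  shows "num_bipartite A B =
    (\<Sum>I | I \<subseteq> {..<length A} \<and> int (card I) = hd B. num_bipartite (decrement_on I A) (tl B))"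
  using assms(1) by (cases B) (simp_all add: num_bipartite_Cons)

end
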